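(* Let $k\ge 4$ be an integer. For every graph $G$, $$\tau_k(G) \le \left\lfloor \frac{k^2}{4} \right\rfloor \tau_k^*(G).$$
   Context: All graphs are finite, simple and undirected. A $K_k$-cover of $G$ is a set of edges meeting every copy of $K_k$ in $G$; $\tau_k(G)$ is its minimum size. A fractional $K_k$-cover is a function $f:E(G)\to[0,\infty)$ such that for every copy of $K_k$ in $G$ the sum of $f$ over its $\binom{k}{2}$ edges is at least $1$; $\tau_k^*(G)$ is the minimum of $\sum_{e} f(e)$ over all fractional $K_k$-covers. *)

theory Defs
  imports "HOL-Analysis.Analysis" "HOL-Library.Ramsey"
begin

definition simple_graph :: "'a set \<Rightarrow> 'a set set \<Rightarrow> bool" where
  "simple_graph V E \<longleftrightarrow> finite V \<and> E \<subseteq> [V]\<^bsup>2\<^esup>"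

text \<open>A copy of \<open>K\<^sub>k\<close> is represented by its vertex set \<open>K\<close>; its edges are then
  exactly the pairs in \<open>[K]\<^bsup>2\<^esup>\<close>.\<close>

definition K_copies :: "nat \<Rightarrow> 'a set \<Rightarrow> 'a set set \<Rightarrow> 'a set set" where
  "K_copies k V E = {K \<in> [V]\<^bsup>k\<^esup>. [K]\<^bsup>2\<^esup> \<subseteq> E}"

definition K_cover :: "nat \<Rightarrow> 'a set \<Rightarrow> 'a set set \<Rightarrow> 'a set set \<Rightarrow> bool" where
  "K_cover k V E F \<longleftrightarrow> F \<subseteq> E \<and> (\<forall>K \<in> K_copies k V E. F \<inter> [K]\<^bsup>2\<^esup> \<noteq> {})"

definition \<tau> :: "nat \<Rightarrow> 'a set \<Rightarrow> 'a set set \<Rightarrow> nat" where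
  "\<tau> k V E = Min (card ` {F. K_cover k V E F})"

text \<open>Only the values of \<open>f\<close> on \<open>E\<close> matter.\<close>

definition frac_K_cover :: "nat \<Rightarrow> 'a set \<Rightarrow> 'a set set \<Rightarrow> ('a set \<Rightarrow> real) \<Rightarrow> bool" where
  "frac_K_cover k V E f \<longleftrightarrow>
    (\<forall>e \<in> E. 0 \<le> f e) \<and> (\<forall>K \<in> K_copies k V E. 1 \<le> (\<Sum>e \<in> [K]\<^bsup>2\<^esup>. f e))"

text \<open>The infimum is a minimum for \<open>k \<ge> 2\<close>: see \<open>\<tau>_frac_attained\<close> below.\<close>

definition \<tau>_frac :: "nat \<Rightarrow> 'a set \<Rightarrow> 'a set set \<Rightarrow> real" where
  "\<tau>_frac k V E = Inf {(\<Sum>e \<in> E. f e) | f. frac_K_cover k V E f}"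

lemma simple_graph_finite_edges: "simple_graph V E \<Longrightarrow> finite E"
  unfolding simple_graph_def by (meson finite_imp_finite_nsets finite_subset)

lemma finite_copy_edges: "simple_graph V E \<Longrightarrow> K \<in> K_copies k V E \<Longrightarrow> finite ([K]\<^bsup>2\<^esup>)"
  unfolding K_copies_def using simple_graph_finite_edges finite_subset by blast

lemma copy_edges_nonempty:
  assumes "k \<ge> 2" "K \<in> K_copies k V E"
  shows "[K]\<^bsup>2\<^esup> \<noteq> {}"
proof -
  have "card K \<ge> 2" using assms by (auto simp: K_copies_def nsets_def)
  then obtain L where "L \<subseteq> K" "card L = 2" "finite L"
    by (meson obtain_subset_with_card_n)
  then show ?thesis by (auto simp: nsets_def)
qed

lemma \<tau>_attained:
  assumes "simple_graph V E" "k \<ge> 2"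
  shows "\<exists>F. K_cover k V E F \<and> card F = \<tau> k V E"
    and "K_cover k V E F \<Longrightarrow> \<tau> k V E \<le> card F"
proof -
  have "{F. K_cover k V E F} \<subseteq> Pow E" by (auto simp: K_cover_def)
  then have fin: "finite (card ` {F. K_cover k V E F})"
    using simple_graph_finite_edges[OF assms(1)] by (meson finite_Pow_iff finite_imageI finite_subset)
  have "K_cover k V E E"
    using copy_edges_nonempty[OF assms(2)] by (fastforce simp: K_cover_def K_copies_def)
  then have "card ` {F. K_cover k V E F} \<noteq> {}" by blast
  from Min_in[OF fin this] show "\<exists>F. K_cover k V E F \<and> card F = \<tau> k V E"
    unfolding \<tau>_def by auto
  show "K_cover k V E F \<Longrightarrow> \<tau> k V E \<le> card F"
    unfolding \<tau>_def using fin by (intro Min_le) auto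
qed

lemma \<tau>_frac_attained:
  assumes G: "simple_graph V E" and k: "k \<ge> 2"
  shows "\<exists>f. frac_K_cover k V E f \<and> (\<Sum>e \<in> E. f e) = \<tau>_frac k V E"
    and "frac_K_cover k V E f \<Longrightarrow> \<tau>_frac k V E \<le> (\<Sum>e \<in> E. f e)"
proof -
  let ?S = "{(\<Sum>e \<in> E. f e) | f. frac_K_cover k V E f}"
  have bdd: "bdd_below ?S"
    by (rule bdd_belowI[of _ 0]) (auto simp: frac_K_cover_def intro!: sum_nonneg)
  then show le: "\<tau>_frac k V E \<le> (\<Sum>e \<in> E. f e)" if "frac_K_cover k V E f" for f
    unfolding \<tau>_frac_def using that by (intro cInf_lower) auto
  define B where "B = (PiE UNIV (\<lambda>_. {0..1}) :: ('a set \<Rightarrow> real) set)"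
  define C where "C = B \<inter> (\<Inter>K \<in> K_copies k V E. {f. 1 \<le> (\<Sum>e \<in> [K]\<^bsup>2\<^esup>. f e)})"
  have cont: "continuous_on UNIV (\<lambda>f :: 'a set \<Rightarrow> real. \<Sum>e \<in> A. f e)" for A
    by (intro continuous_on_sum continuous_on_product_coordinates)
  have "compact B"
  proof -
    have "compactin (product_topology (\<lambda>_. euclidean) UNIV) B"
      unfolding B_def by (subst compactin_PiE) auto
    then show ?thesis by (simp add: euclidean_product_topology)
  qed
  moreover have "closed (\<Inter>K \<in> K_copies k V E. {f :: 'a set \<Rightarrow> real. 1 \<le> (\<Sum>e \<in> [K]\<^bsup>2\<^esup>. f e)})"
    by (intro closed_INT ballI closed_Collect_le continuous_on_const cont)
  ultimately have "compact C" unfolding C_def by (rule compact_Int_closed)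
  have trunc: "(\<lambda>e. if e \<in> E then min 1 (f e) else 0) \<in> C" if f: "frac_K_cover k V E f" for f
  proof -
    have "1 \<le> (\<Sum>e \<in> [K]\<^bsup>2\<^esup>. if e \<in> E then min 1 (f e) else 0)" if K: "K \<in> K_copies k V E" for K
    proof -
      have sub: "[K]\<^bsup>2\<^esup> \<subseteq> E" using K by (auto simp: K_copies_def)
      have nn: "\<forall>e \<in> [K]\<^bsup>2\<^esup>. 0 \<le> f e" using sub f by (auto simp: frac_K_cover_def)
      have fin: "finite ([K]\<^bsup>2\<^esup>)" using finite_copy_edges[OF G K] .
      have "1 \<le> (\<Sum>e \<in> [K]\<^bsup>2\<^esup>. min 1 (f e))"
      proof (cases "\<exists>e \<in> [K]\<^bsup>2\<^esup>. 1 \<le> f e")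
        case True
        then obtain e where e: "e \<in> [K]\<^bsup>2\<^esup>" "1 \<le> f e" by blast
        have "min 1 (f e) \<le> (\<Sum>e \<in> [K]\<^bsup>2\<^esup>. min 1 (f e))"
          using e nn fin by (intro member_le_sum) auto
        then show ?thesis using e by simp
      next
        case False
        then have "(\<Sum>e \<in> [K]\<^bsup>2\<^esup>. min 1 (f e)) = (\<Sum>e \<in> [K]\<^bsup>2\<^esup>. f e)"
          by (intro sum.cong) auto
        then show ?thesis using f K by (simp add: frac_K_cover_def)
      qed
      also have "\<dots> = (\<Sum>e \<in> [K]\<^bsup>2\<^esup>. if e \<in> E then min 1 (f e) else 0)"
        using sub by (intro sum.cong) auto
      finally show ?thesis .
    qed
    then show ?thesis using f by (auto simp: C_def B_def frac_K_cover_def)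
  qed
  have "frac_K_cover k V E (\<lambda>_. 1)"
  proof -
    have "1 \<le> real (card ([K]\<^bsup>2\<^esup>))" if "K \<in> K_copies k V E" for K
      using copy_edges_nonempty[OF k that] finite_copy_edges[OF G that]
      by (metis One_nat_def Suc_leI card_gt_0_iff of_nat_1 of_nat_le_iff)
    then show ?thesis by (simp add: frac_K_cover_def del: card_nsets)
  qed
  with trunc have "C \<noteq> {}" by blast
  from continuous_attains_inf[OF \<open>compact C\<close> this continuous_on_subset[OF cont subset_UNIV]]
  obtain f where f: "f \<in> C" "\<And>g. g \<in> C \<Longrightarrow> (\<Sum>e \<in> E. f e) \<le> (\<Sum>e \<in> E. g e)" by metis
  have fc: "frac_K_cover k V E f" using f(1) by (auto simp: C_def B_def frac_K_cover_def PiE_iff)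
  have "(\<Sum>e \<in> E. f e) \<le> (\<Sum>e \<in> E. g e)" if "frac_K_cover k V E g" for g
    by (rule order_trans[OF f(2)[OF trunc[OF that]]]) (intro sum_mono, auto)
  then have "(\<Sum>e \<in> E. f e) \<le> \<tau>_frac k V E"
    unfolding \<tau>_frac_def using fc by (intro cInf_greatest) auto
  with le[OF fc] fc show "\<exists>f. frac_K_cover k V E f \<and> (\<Sum>e \<in> E. f e) = \<tau>_frac k V E"
    by (meson antisym)
qed

end

theory Submission
  imports Defs
begin

text \<open>Put \<open>M = \<lfloor>k\<^sup>2/4\<rfloor>\<close>. An edge of weight at least \<open>1/M\<close> in an optimal fractional cover can be put
  into the cover and deleted from the graph, so by induction all weights may be assumed smaller
  than \<open>1/M\<close>. Then every copy of \<open>K\<^sub>k\<close> has more than \<open>M\<close> edges of positive weight, and by Mantel's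
  theorem three of them form a triangle. Hence the edges inside the two sides of a maximum cut of
  the graph \<open>H\<close> of positive edges form a cover of size at most \<open>|H|/2\<close>. Finally
  \<open>|H| \<le> (k choose 2) \<tau>*\<close>: otherwise scaling the optimal weights up and subtracting a small
  constant from the positive ones would improve them. This replaces complementary slackness.\<close>

section \<open>Triangle-free graphs and large cuts\<close>

text \<open>Remove both ends of an edge. In a triangle-free graph no other vertex is adjacent to
  both, so with \<open>n\<close> vertices left at most \<open>n + 1\<close> edges are lost, and
  \<open>n\<^sup>2 + 4 * (n + 1) = (n + 2)\<^sup>2\<close>.\<close>

lemma Mantel:
  assumes "finite K" "A \<subseteq> [K]\<^bsup>2\<^esup>"
    and "\<And>x y z. \<lbrakk>{x,y} \<in> A; {y,z} \<in> A; {x,z} \<in> A\<rbrakk> \<Longrightarrow> False"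
  shows "4 * card A \<le> (card K)\<^sup>2"
  using assms
proof (induction "card K" arbitrary: K A rule: less_induct)
  case less
  show ?case
  proof (cases "A = {}")
    case False
    then obtain e where "e \<in> A" by blast
    then obtain x y where xy: "x \<noteq> y" "x \<in> K" "y \<in> K" "{x,y} \<in> A"
      using less.prems(2) by (auto simp: nsets_def card_2_iff)
    define K' where "K' = K - {x,y}"
    define A' where "A' = A \<inter> [K']\<^bsup>2\<^esup>"
    \<comment> \<open>\<open>g z\<close> is the only candidate for an edge of \<open>A\<close> from
      \<open>z\<close> to \<open>{x,y}\<close>. If there is no such edge, the value
      \<open>{y,z}\<close> does no harm, since only an upper bound on \<open>card A\<close> is
      sought.\<close>
    define g where "g z = (if {x,z} \<in> A then {x,z} else {y,z})" for z
    have cardK: "card K = card K' + 2"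
    proof -
      have "card {x,y} \<le> card K" using xy less.prems(1) by (intro card_mono) auto
      then show ?thesis using xy less.prems(1) by (simp add: K'_def card_Diff_subset)
    qed
    have finK': "finite K'" using less.prems(1) by (simp add: K'_def)
    have IH: "4 * card A' \<le> (card K')\<^sup>2"
      by (rule less.hyps) (use cardK finK' less.prems(3) in \<open>auto simp: A'_def\<close>)
    have sub: "A \<subseteq> A' \<union> insert {x,y} (g ` K')"
    proof
      fix e assume e: "e \<in> A"
      then obtain a b where ab: "e = {a,b}" "a \<noteq> b" "a \<in> K" "b \<in> K"
        using less.prems(2) by (auto simp: nsets_def card_2_iff)
      have cross: "{u,z} \<in> g ` K'" if "{u,z} \<in> A" "u \<in> {x,y}" "z \<in> K'" for u z
      proof -
        \<comment> \<open>If \<open>u\<close> is \<open>y\<close>, then \<open>{x,z} \<in> A\<close>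
          would close a triangle on \<open>x\<close>, \<open>y\<close>, \<open>z\<close>.\<close>
        have "g z = {u,z}"
          using that less.prems(3)[of x y z] xy(4) by (auto simp: g_def)
        then show ?thesis using that(3) by (metis imageI)
      qed
      consider "a \<in> K'" "b \<in> K'" | "a \<in> {x,y}" "b \<in> K'" | "b \<in> {x,y}" "a \<in> K'"
        | "a \<in> {x,y}" "b \<in> {x,y}"
        using ab by (auto simp: K'_def)
      then show "e \<in> A' \<union> insert {x,y} (g ` K')"
      proof cases
        case 1
        then show ?thesis using e ab by (auto simp: A'_def nsets_def)
      next
        case 2
        then show ?thesis using cross[of a b] e ab by simp
      next
        case 3
        then show ?thesis using cross[of b a] e ab by (simp add: insert_commute)
      next
        case 4
        then show ?thesis using ab by auto
      qed
    qed
    have fin': "finite A'" using finK' by (simp add: A'_def finite_imp_finite_nsets)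
    have "card A \<le> card (A' \<union> insert {x,y} (g ` K'))"
      using sub fin' finK' by (intro card_mono) auto
    also have "\<dots> \<le> card A' + (card (g ` K') + 1)"
      by (rule order_trans[OF card_Un_le]) (use finK' in \<open>simp add: card_insert_if\<close>)
    also have "\<dots> \<le> card A' + card K' + 1"
      using card_image_le[OF finK', of g] by simp
    finally show ?thesis using IH cardK by (simp add: power2_eq_square algebra_simps)
  qed auto
qed

text \<open>The cut is built greedily: each new vertex joins the side that leaves at most half of
  its edges to earlier vertices uncut.\<close>

lemma max_cut_at_least_half:
  assumes "finite V" "H \<subseteq> [V]\<^bsup>2\<^esup>"
  shows "\<exists>S. 2 * card {e \<in> H. e \<subseteq> S \<or> e \<inter> S = {}} \<le> card H"
proof -
  \<comment> \<open>The bound \<open>S \<subseteq> V\<close> is carried along so that the vertex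
    inserted next is not yet in \<open>S\<close>.\<close>
  have "\<exists>S\<subseteq>V. 2 * card {e \<in> H. e \<subseteq> S \<or> e \<inter> S = {}} \<le> card H"
    using assms
  proof (induction V arbitrary: H rule: finite_induct)
    case empty
    then have "H = {}" by (auto simp: nsets_def)
    then show ?case by auto
  next
    case (insert v V)
    define H' where "H' = H \<inter> [V]\<^bsup>2\<^esup>"
    define N where "N = {e \<in> H. v \<in> e}"
    obtain S where S: "S \<subseteq> V" "2 * card {e \<in> H'. e \<subseteq> S \<or> e \<inter> S = {}} \<le> card H'"
      using insert.IH[of H'] by (auto simp: H'_def)
    have finH: "finite H"
      using insert.prems insert.hyps(1) by (meson finite.insertI finite_imp_finite_nsets finite_subset)
    have edges: "\<exists>u\<in>V. e = {v,u} \<and> u \<noteq> v" if "e \<in> N" for e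
      using that insert.prems by (fastforce simp: N_def nsets_def card_2_iff)
    have H: "H = H' \<union> N" "H' \<inter> N = {}"
      using insert.prems insert.hyps(2) by (auto simp: H'_def N_def nsets_def)
    have fin: "finite H'" "finite N" using finH by (auto simp: H'_def N_def)
    \<comment> \<open>\<open>B0\<close> and \<open>B1\<close> are the edges at \<open>v\<close> left
      uncut when \<open>v\<close> stays outside \<open>S\<close> or joins \<open>S\<close>,
      respectively.\<close>
    define B0 where "B0 = {e \<in> N. e \<inter> S = {}}"
    define B1 where "B1 = {e \<in> N. e \<subseteq> insert v S}"
    have "B0 \<inter> B1 = {}"
      unfolding B0_def B1_def using edges by fastforce
    then have "card B0 + card B1 = card (B0 \<union> B1)"
      using fin by (subst card_Un_disjoint) (auto simp: B0_def B1_def)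
    also have "\<dots> \<le> card N" using fin by (intro card_mono) (auto simp: B0_def B1_def)
    finally have BN: "card B0 + card B1 \<le> card N" .
    have cH: "card H = card H' + card N" using H fin by (metis card_Un_disjoint)
    let ?bad = "{e \<in> H'. e \<subseteq> S \<or> e \<inter> S = {}}"
    have vH': "v \<notin> e" if "e \<in> H'" for e using that insert.hyps(2) by (auto simp: H'_def nsets_def)
    have vS: "v \<notin> S" using S(1) insert.hyps(2) by blast
    have "{e \<in> H. e \<subseteq> S \<or> e \<inter> S = {}} = ?bad \<union> B0"
      using H(1) vS by (auto simp: B0_def N_def)
    then have c0: "card {e \<in> H. e \<subseteq> S \<or> e \<inter> S = {}} \<le> card ?bad + card B0"
      by (simp only: card_Un_le)
    have "{e \<in> H. e \<subseteq> insert v S \<or> e \<inter> insert v S = {}} = ?bad \<union> B1"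
      using H(1) vH' by (auto simp: B1_def N_def)
    then have c1: "card {e \<in> H. e \<subseteq> insert v S \<or> e \<inter> insert v S = {}} \<le> card ?bad + card B1"
      by (simp only: card_Un_le)
    show ?case
    proof (cases "card B0 \<le> card B1")
      case True
      then show ?thesis using c0 S BN cH by (intro exI[of _ S]) auto
    next
      case False
      then show ?thesis using c1 S BN cH by (intro exI[of _ "insert v S"]) auto
    qed
  qed
  then show ?thesis by blast
qed

section \<open>Edge deletion and supports of optimal fractional covers\<close>

lemma simple_graph_mono: "simple_graph V E \<Longrightarrow> E' \<subseteq> E \<Longrightarrow> simple_graph V E'"
  by (auto simp: simple_graph_def)

lemma \<tau>_le_Suc_\<tau>_delete_edge:
  assumes "simple_graph V E" "k \<ge> 2" "e \<in> E"
  shows "\<tau> k V E \<le> Suc (\<tau> k V (E - {e}))"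
proof -
  have G': "simple_graph V (E - {e})" using assms(1) by (rule simple_graph_mono) blast
  obtain F where F: "K_cover k V (E - {e}) F" "card F = \<tau> k V (E - {e})"
    using \<tau>_attained(1)[OF G' assms(2)] by blast
  have "K_cover k V E (insert e F)"
    using F(1) assms(3) by (auto simp: K_cover_def K_copies_def)
  then have "\<tau> k V E \<le> card (insert e F)" by (rule \<tau>_attained(2)[OF assms(1,2)])
  also have "\<dots> \<le> Suc (card F)" by (cases "finite F") (auto simp: card_insert_if)
  finally show ?thesis by (simp add: F(2))
qed

lemma frac_K_cover_mono: "frac_K_cover k V E f \<Longrightarrow> E' \<subseteq> E \<Longrightarrow> frac_K_cover k V E' f"
  by (auto simp: frac_K_cover_def K_copies_def)

text \<open>With \<open>N\<close> the number of edges of a copy, the perturbation \<open>f'\<close>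
  is again a cover: a copy loses at most \<open>\<epsilon> * N\<close> by the subtraction and
  regains at least that by the scaling. Its total weight exceeds the optimum by
  \<open>\<epsilon>\<close> times \<open>N * \<tau>_frac k V E - card H\<close>, which therefore
  cannot be negative.\<close>

lemma card_support_optimal_frac_K_cover_le:
  assumes G: "simple_graph V E" and k: "k \<ge> 2"
    and f: "frac_K_cover k V E f" "(\<Sum>e\<in>E. f e) = \<tau>_frac k V E"
  shows "real (card {e\<in>E. f e > 0}) \<le> real (k choose 2) * \<tau>_frac k V E"
proof (cases "{e\<in>E. f e > 0} = {}")
  case True
  have "0 \<le> \<tau>_frac k V E" using f by (auto simp: frac_K_cover_def intro: sum_nonneg simp flip: f(2))
  then show ?thesis by (simp only: True) simp
next
  case False
  define H where "H = {e\<in>E. f e > 0}"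
  define N where "N = real (k choose 2)"
  \<comment> \<open>The least positive weight is the most that can be subtracted on all of
    \<open>H\<close> while keeping weights nonnegative; the minimum exists because the case of empty
    support is split off.\<close>
  define \<epsilon> where "\<epsilon> = Min (f ` H)"
  define f' where "f' e = (1 + \<epsilon> * N) * f e - \<epsilon> * indicator H e" for e
  have finE: "finite E" using G by (rule simple_graph_finite_edges)
  then have finH: "finite H" by (simp add: H_def)
  have \<epsilon>: "\<epsilon> > 0" "\<And>e. e \<in> H \<Longrightarrow> \<epsilon> \<le> f e"
    using False finH by (auto simp: \<epsilon>_def H_def)
  have N: "N \<ge> 0" by (simp add: N_def)
  have "frac_K_cover k V E f'"
    unfolding frac_K_cover_def
  proof (intro conjI ballI)
    fix e assume e: "e \<in> E"
    have "0 \<le> f e" using f(1) e by (auto simp: frac_K_cover_def)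
    then have "0 \<le> \<epsilon> * N * f e" using \<epsilon>(1) N by simp
    then show "0 \<le> f' e"
      using \<epsilon>(2)[of e] \<open>0 \<le> f e\<close> by (cases "e \<in> H") (auto simp: f'_def algebra_simps)
  next
    fix K assume K: "K \<in> K_copies k V E"
    have cK: "card K = k" using K by (auto simp: K_copies_def nsets_def)
    have "(\<Sum>e\<in>[K]\<^bsup>2\<^esup>. indicator H e) \<le> (\<Sum>e\<in>[K]\<^bsup>2\<^esup>. 1::real)"
      by (intro sum_mono) (auto simp: indicator_def)
    also have "\<dots> = N" using cK by (simp add: N_def)
    finally have ind: "(\<Sum>e\<in>[K]\<^bsup>2\<^esup>. indicator H e) \<le> N" .
    have "1 \<le> (\<Sum>e\<in>[K]\<^bsup>2\<^esup>. f e)" using f(1) K by (simp add: frac_K_cover_def)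
    then have "(1 + \<epsilon> * N) * 1 - \<epsilon> * N
        \<le> (1 + \<epsilon> * N) * (\<Sum>e\<in>[K]\<^bsup>2\<^esup>. f e) - \<epsilon> * (\<Sum>e\<in>[K]\<^bsup>2\<^esup>. indicator H e)"
      using ind \<epsilon>(1) N by (intro diff_mono mult_left_mono) auto
    then show "1 \<le> (\<Sum>e\<in>[K]\<^bsup>2\<^esup>. f' e)"
      by (simp add: f'_def sum_subtractf sum_distrib_left)
  qed
  then have "\<tau>_frac k V E \<le> (\<Sum>e\<in>E. f' e)" by (rule \<tau>_frac_attained(2)[OF G k])
  also have "\<dots> = (1 + \<epsilon> * N) * \<tau>_frac k V E - \<epsilon> * (\<Sum>e\<in>E. indicator H e)"
    by (simp add: f'_def sum_subtractf sum_distrib_left flip: f(2))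
  also have "(\<Sum>e\<in>E. indicator H e) = real (card H)"
  proof -
    have "E \<inter> H = H" by (auto simp: H_def)
    then show ?thesis using finE by (simp add: indicator_def sum.If_cases)
  qed
  finally have "\<epsilon> * real (card H) \<le> \<epsilon> * (N * \<tau>_frac k V E)" by (simp add: algebra_simps)
  then show ?thesis using \<epsilon>(1) by (simp add: H_def N_def)
qed

section \<open>From small weights to an integral cover\<close>

lemma K_copy_has_positive_triangle:
  assumes G: "simple_graph V E" and f: "frac_K_cover k V E f" and K: "K \<in> K_copies k V E"
    and M: "k\<^sup>2 < 4 * (M + 1)" and small: "\<And>e. e \<in> E \<Longrightarrow> real M * f e < 1"
  obtains x y z where "x \<in> K" "y \<in> K" "z \<in> K"
    "{{x,y}, {y,z}, {x,z}} \<subseteq> {e\<in>E. f e > 0}"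
proof -
  define A where "A = {e \<in> [K]\<^bsup>2\<^esup>. f e > 0}"
  have sub: "[K]\<^bsup>2\<^esup> \<subseteq> E" and cK: "card K = k" "finite K" using K by (auto simp: K_copies_def nsets_def)
  have fin: "finite ([K]\<^bsup>2\<^esup>)" using finite_copy_edges[OF G K] .
  have finA: "finite A" using fin by (simp add: A_def)
  have zero: "f e = 0" if "e \<in> [K]\<^bsup>2\<^esup> - A" for e
    using that sub f by (fastforce simp: A_def frac_K_cover_def)
  have "1 \<le> (\<Sum>e\<in>[K]\<^bsup>2\<^esup>. f e)" using f K by (simp add: frac_K_cover_def)
  also have "\<dots> = (\<Sum>e\<in>A. f e)"
    using zero fin by (intro sum.mono_neutral_right) (auto simp: A_def)
  finally have one: "1 \<le> (\<Sum>e\<in>A. f e)" .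
  \<comment> \<open>Nonemptiness makes the termwise strict bound on \<open>A\<close> strict for the
    sum, giving more than \<open>M\<close> positive edges.\<close>
  then have "A \<noteq> {}" by auto
  have "real M * 1 \<le> real M * (\<Sum>e\<in>A. f e)" using one by (intro mult_left_mono) auto
  also have "\<dots> = (\<Sum>e\<in>A. real M * f e)" by (rule sum_distrib_left)
  also have "\<dots> < (\<Sum>e\<in>A. 1)"
    using \<open>A \<noteq> {}\<close> finA small sub by (intro sum_strict_mono) (auto simp: A_def)
  finally have "M < card A" by simp
  then have "\<not> 4 * card A \<le> (card K)\<^sup>2" using M by (simp add: cK(1))
  moreover have "A \<subseteq> [K]\<^bsup>2\<^esup>" by (auto simp: A_def)
  ultimately obtain x y z where xyz: "{x,y} \<in> A" "{y,z} \<in> A" "{x,z} \<in> A"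
    using Mantel[OF cK(2)] by blast
  then show thesis using sub by (intro that[of x y z]) (auto simp: A_def nsets_def)
qed

text \<open>The two bounds on \<open>M\<close> serve different ends: the first puts
  \<open>M + 1\<close> edges above Mantel's bound, the second makes half of
  \<open>k choose 2\<close> at most \<open>M\<close>.\<close>

lemma \<tau>_le_mult_\<tau>_frac:
  assumes k: "k \<ge> 2" and M: "k\<^sup>2 < 4 * (M + 1)" "k * (k - 1) \<le> 4 * M" and G: "simple_graph V E"
  shows "real (\<tau> k V E) \<le> real M * \<tau>_frac k V E"
  using G
proof (induction "card E" arbitrary: E rule: less_induct)
  case less
  note G = less.prems
  have finE: "finite E" using G by (rule simple_graph_finite_edges)
  obtain f where f: "frac_K_cover k V E f" "(\<Sum>e\<in>E. f e) = \<tau>_frac k V E"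
    using \<tau>_frac_attained(1)[OF G k] by blast
  show ?case
  proof (cases "\<exists>e\<in>E. 1 \<le> real M * f e")
    case True
    then obtain e where e: "e \<in> E" "1 \<le> real M * f e" by blast
    have G': "simple_graph V (E - {e})" using G by (rule simple_graph_mono) blast
    have "real (\<tau> k V E) \<le> 1 + real (\<tau> k V (E - {e}))"
      using \<tau>_le_Suc_\<tau>_delete_edge[OF G k e(1)] by simp
    also have "real (\<tau> k V (E - {e})) \<le> real M * \<tau>_frac k V (E - {e})"
      using less.hyps[OF _ G'] card_Diff1_less[OF finE e(1)] by blast
    \<comment> \<open>The same \<open>f\<close> covers the smaller graph, so the right-hand side
      drops by at least \<open>real M * f e \<ge> 1\<close>, which pays for the deleted
      edge.\<close>
    also have "\<dots> \<le> real M * (\<Sum>e\<in>E - {e}. f e)"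
      using frac_K_cover_mono[OF f(1)]
      by (intro mult_left_mono \<tau>_frac_attained(2)[OF G' k]) auto
    also have "(\<Sum>e\<in>E - {e}. f e) = \<tau>_frac k V E - f e"
      using finE e(1) by (simp add: sum_diff1 f(2))
    finally show ?thesis using e(2) by (simp add: algebra_simps)
  next
    case False
    then have small: "\<And>e. e \<in> E \<Longrightarrow> real M * f e < 1" by force
    define H where "H = {e\<in>E. f e > 0}"
    have HV: "H \<subseteq> [V]\<^bsup>2\<^esup>" "finite V" using G by (auto simp: H_def simple_graph_def)
    then obtain S where S: "2 * card {e \<in> H. e \<subseteq> S \<or> e \<inter> S = {}} \<le> card H"
      using max_cut_at_least_half by blast
    define F where "F = {e \<in> H. e \<subseteq> S \<or> e \<inter> S = {}}"
    have "F \<inter> [K]\<^bsup>2\<^esup> \<noteq> {}" if K: "K \<in> K_copies k V E" for K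
    proof -
      obtain x y z where xyz: "x \<in> K" "y \<in> K" "z \<in> K" "{{x,y}, {y,z}, {x,z}} \<subseteq> H"
        using K_copy_has_positive_triangle[OF G f(1) K M(1), folded H_def] small by blast
      have HK: "e \<in> [K]\<^bsup>2\<^esup>" if "e \<in> H" "e \<subseteq> K" for e
        using that HV(1) by (auto simp: nsets_def)
      \<comment> \<open>Two of the three vertices lie on the same side of the cut.\<close>
      have "{x,y} \<in> F \<or> {y,z} \<in> F \<or> {x,z} \<in> F" using xyz(4) by (auto simp: F_def)
      then show ?thesis using HK xyz by blast
    qed
    then have "K_cover k V E F" by (auto simp: K_cover_def F_def H_def)
    then have "\<tau> k V E \<le> card F" by (rule \<tau>_attained(2)[OF G k])
    then have "real (\<tau> k V E) \<le> real (card H) / 2" using S by (simp add: F_def)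
    also have "\<dots> \<le> real (k choose 2) * \<tau>_frac k V E / 2"
      using card_support_optimal_frac_K_cover_le[OF G k f] by (simp add: H_def)
    also have "\<dots> \<le> real M * \<tau>_frac k V E"
    proof -
      have "k choose 2 \<le> 2 * M" using M(2) by (simp add: choose_two)
      then have "real (k choose 2) \<le> 2 * real M" by linarith
      moreover have "0 \<le> \<tau>_frac k V E"
        using f by (auto simp: frac_K_cover_def intro: sum_nonneg simp flip: f(2))
      ultimately show ?thesis using mult_right_mono by fastforce
    qed
    finally show ?thesis .
  qed
qed

theorem theorem3p2:
  fixes k :: nat and V :: "'a set" and E :: "'a set set"
  assumes "k \<ge> 4" and "simple_graph V E"
  shows "real (\<tau> k V E) \<le> of_int \<lfloor>(real k)\<^sup>2 / 4\<rfloor> * \<tau>_frac k V E"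
proof -
  define M where "M = k\<^sup>2 div 4"
  have floor: "\<lfloor>(real k)\<^sup>2 / 4\<rfloor> = int M"
    using floor_divide_of_nat_eq[of "k\<^sup>2" 4, where ?'a = real] by (simp add: M_def)
  \<comment> \<open>Rounding costs little: \<open>k\<^sup>2 - 4 * M\<close> is 0 for even
    \<open>k\<close> and 1 for odd \<open>k\<close>, while \<open>k * (k - 1)\<close> is smaller
    than \<open>k\<^sup>2\<close> by \<open>k\<close>.\<close>
  have "k * (k - 1) \<le> 4 * M"
  proof (cases "even k")
    case True
    then obtain m where "k = 2 * m" by blast
    then show ?thesis by (simp add: M_def power2_eq_square algebra_simps)
  next
    case False
    then obtain m where m: "k = 2 * m + 1" by (rule oddE)
    have "k\<^sup>2 = 1 + 4 * (m * m + m)" by (simp add: m power2_eq_square algebra_simps)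
    then have "M = m * m + m" by (simp add: M_def)
    then show ?thesis by (simp add: m algebra_simps)
  qed
  moreover have "k\<^sup>2 < 4 * (M + 1)" unfolding M_def by presburger
  ultimately have "real (\<tau> k V E) \<le> real M * \<tau>_frac k V E"
    using assms by (intro \<tau>_le_mult_\<tau>_frac) auto
  then show ?thesis by (simp add: floor)
qed

end
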